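(* Let $a>0$ and $b>0$. For any $b>0$, the hazard function of the beta-exponential distribution with parameters $a$ and $b$, considered on $(0,+\infty)$, is decreasing if $a<1$, increasing if $a>1$, and constantly equal to $b$ if $a=1$.
   Context: The beta-exponential distribution with parameters $a,b>0$ is the distribution with density $g(x;a,b)=\frac{1}{B(a,b)}(1-\mathrm{e}^{-x})^{a-1}\mathrm{e}^{-bx}\mathbf{1}_{(0,+\infty)}(x)$, where $B(a,b)=\int_0^{+\infty}(1-\mathrm{e}^{-x})^{a-1}\mathrm{e}^{-bx}\,\mathrm{d}x$ is the beta function. The hazard function of an absolutely continuous random variable $X$ with probability density function $f_X$ and cumulative distribution function $F_X$ is $x\mapsto \frac{f_X(x)}{1-F_X(x)}$. "Increasing" and "decreasing" are meant strictly: $h$ is increasing (resp. decreasing) if $x<y$ implies $h(x)<h(y)$ (resp. $h(x)>h(y)$). *)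

theory Defs
  imports "HOL-Probability.Probability"
begin

definition beta_exponential_density :: "real \<Rightarrow> real \<Rightarrow> real \<Rightarrow> real" where
  "beta_exponential_density a b x =
     1 / Beta a b * (1 - exp (- x)) powr (a - 1) * exp (- b * x) * indicator {0<..} x"

text \<open>
  The hazard function depends on the chosen version of the density, so it takes the density
  itself (with respect to Lebesgue measure) as argument, not the distribution.
\<close>
definition hazard_function :: "(real \<Rightarrow> real) \<Rightarrow> real \<Rightarrow> real" where
  "hazard_function f x = f x / (1 - cdf (density lborel (\<lambda>t. ennreal (f t))) x)"

text \<open>
  The normalising constant, here the library's \<^const>\<open>Beta\<close> (defined through \<^const>\<open>Gamma\<close>),
  is the integral of the unnormalised density.
\<close>
lemma has_integral_Beta_exp:
  fixes a b :: real
  assumes "a > 0" "b > 0"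
  shows "((\<lambda>x. (1 - exp (- x)) powr (a - 1) * exp (- b * x)) has_integral Beta a b) {0<..}"
proof -
  let ?g = "\<lambda>x::real. exp (- x)"
  let ?f = "\<lambda>t. t powr (b - 1) * (1 - t) powr (a - 1)"
  have img: "?g ` {0<..} = {0<..<1}"
  proof (intro equalityI subsetI)
    fix t :: real assume "t \<in> {0<..<1}"
    then have "t = ?g (- ln t)" "- ln t \<in> {0<..}" by auto
    then show "t \<in> ?g ` {0<..}" by blast
  qed auto
  have I: "(?f has_integral Beta b a) {0<..<1}"
    using has_integral_Beta_real[OF assms(2,1)] by (simp add: has_integral_Icc_iff_Ioo)
  have "?f absolutely_integrable_on {0<..<1}"
    using I by (intro nonnegative_absolutely_integrable_1) (auto simp: has_integral_iff)
  with I have "?f absolutely_integrable_on ?g ` {0<..} \<and> integral (?g ` {0<..}) ?f = Beta a b"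
    by (simp add: img has_integral_iff Beta_commute)
  then have "(\<lambda>x. \<bar>- ?g x\<bar> * ?f (?g x)) absolutely_integrable_on {0<..} \<and>
      integral {0<..} (\<lambda>x. \<bar>- ?g x\<bar> * ?f (?g x)) = Beta a b"
    by (subst has_absolute_integral_change_of_variables_1')
       (auto intro!: derivative_eq_intros simp: inj_on_def)
  then have "((\<lambda>x. \<bar>- ?g x\<bar> * ?f (?g x)) has_integral Beta a b) {0<..}"
    by (auto simp: has_integral_iff absolutely_integrable_on_def)
  moreover have "\<bar>- ?g x\<bar> * ?f (?g x) = (1 - exp (- x)) powr (a - 1) * exp (- b * x)" for x
    by (simp add: powr_def mult.assoc flip: exp_add) (simp add: algebra_simps flip: exp_add)
  ultimately show ?thesis by (simp only:)
qed

lemma prob_space_beta_exponential: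
  fixes a b :: real
  assumes "a > 0" "b > 0"
  shows "prob_space (density lborel (\<lambda>x. ennreal (beta_exponential_density a b x)))"
proof
  have B: "Beta a b > 0"
    using assms by (simp add: Beta_def Gamma_real_pos)
  have "((\<lambda>x. 1 / Beta a b * ((1 - exp (- x)) powr (a - 1) * exp (- b * x))) has_integral
      1 / Beta a b * Beta a b) {0<..}"
    by (intro has_integral_mult_right has_integral_Beta_exp assms)
  then have "(beta_exponential_density a b has_integral 1) {0<..}"
    using B by (subst has_integral_cong) (auto simp: beta_exponential_density_def mult.assoc)
  then have "(beta_exponential_density a b has_integral 1) UNIV"
    by (subst (asm) has_integral_restrict_UNIV[symmetric])
       (erule has_integral_eq[rotated], auto simp: beta_exponential_density_def)
  then have "(\<integral>\<^sup>+x. ennreal (beta_exponential_density a b x) \<partial>lborel) = ennreal 1"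
    using B by (intro nn_integral_has_integral_lborel)
      (auto simp: beta_exponential_density_def[abs_def])
  then show "emeasure (density lborel (\<lambda>x. ennreal (beta_exponential_density a b x)))
      (space (density lborel (\<lambda>x. ennreal (beta_exponential_density a b x)))) = 1"
    by (simp add: emeasure_density beta_exponential_density_def[abs_def])
qed

end

(* The reciprocal of the hazard function at x is the integral over t > 0 of f (x + t) / f x.
   For the beta-exponential density this quotient equals
   ((1 - exp (- x - t)) / (1 - exp (- x))) powr (a - 1) * exp (- b * t),
   and the base of the power is strictly decreasing in x for every t > 0. Hence, for every t,
   the integrand is strictly monotone in x, in a direction determined by the sign of a - 1. *)
theory Submission
  imports Defs
begin

text \<open>Translating by \<open>x\<close> moves the tail integral over \<open>{x<..}\<close> to
  the domain \<open>{0<..}\<close>, the same for every \<open>x\<close>; tails at two different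
  points can then be compared integrand by integrand.\<close>

lemma one_minus_cdf_density:
  fixes f :: "real \<Rightarrow> real"
  assumes "prob_space (density lborel (\<lambda>t. ennreal (f t)))"
    and [measurable]: "f \<in> borel_measurable borel" and nonneg: "\<And>t. 0 \<le> f t"
  shows "integrable lborel (\<lambda>t. indicator {0<..} t * f (x + t))"
    and "1 - cdf (density lborel (\<lambda>t. ennreal (f t))) x
           = (\<integral>t. indicator {0<..} t * f (x + t) \<partial>lborel)"
proof -
  let ?M = "density lborel (\<lambda>t. ennreal (f t))"
  interpret prob_space ?M by fact
  have "(\<integral>\<^sup>+ t. ennreal (f t) \<partial>lborel) = 1"
    using emeasure_space_1 by (simp add: emeasure_density)
  then have f: "integrable lborel f"
    by (intro integrableI_nonneg) (auto simp: nonneg)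
  have g: "integrable lborel (\<lambda>t. indicator {x<..} t * f t)"
    using integrable_mult_indicator[OF _ f, of "{x<..}"] by simp
  have shift: "indicator {x<..} (x + t) = (indicator {0<..} t :: real)" for t
    by (simp add: indicator_def)
  show "integrable lborel (\<lambda>t. indicator {0<..} t * f (x + t))"
    using lborel_integrable_real_affine[OF g, of 1 x] by (simp add: shift)
  have "1 - cdf ?M x = measure ?M {x<..}"
    using prob_compl[of "{..x}"] by (simp add: cdf_def Compl_eq_Diff_UNIV[symmetric])
  also have "\<dots> = (\<integral>t. indicator {x<..} t * f t \<partial>lborel)"
  proof -
    have "emeasure ?M {x<..} = (\<integral>\<^sup>+ t. ennreal (indicator {x<..} t * f t) \<partial>lborel)"
      by (subst emeasure_density) (auto intro!: nn_integral_cong split: split_indicator)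
    also have "\<dots> = ennreal (\<integral>t. indicator {x<..} t * f t \<partial>lborel)"
      by (rule nn_integral_eq_integral[OF g]) (simp add: nonneg)
    finally show ?thesis
      by (simp add: measure_def nonneg integral_nonneg_AE)
  qed
  also have "\<dots> = (\<integral>t. indicator {0<..} t * f (x + t) \<partial>lborel)"
    by (subst lborel_integral_real_affine[of 1 _ x]) (simp_all add: shift)
  finally show "1 - cdf ?M x = (\<integral>t. indicator {0<..} t * f (x + t) \<partial>lborel)" .
qed

text \<open>The difference of the integrands is nonnegative, so if its integral were zero it would
  vanish almost everywhere; being positive on all of \<open>{0<..}\<close>, it would make that
  half-line a null set.\<close>

lemma lborel_integral_less_Ioi:
  fixes g h :: "real \<Rightarrow> real"
  assumes "integrable lborel (\<lambda>t. indicator {0<..} t * g t)"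
    and "integrable lborel (\<lambda>t. indicator {0<..} t * h t)"
    and "\<And>t. 0 < t \<Longrightarrow> g t < h t"
  shows "(\<integral>t. indicator {0<..} t * g t \<partial>lborel) < (\<integral>t. indicator {0<..} t * h t \<partial>lborel)"
proof -
  let ?d = "\<lambda>t. indicator {0<..} t * h t - indicator {0<..} t * g t"
  have d: "integrable lborel ?d"
    using assms by (intro Bochner_Integration.integrable_diff)
  have nonneg: "0 \<le> ?d t" for t
    using assms(3)[of t] by (auto simp: indicator_def intro: less_imp_le)
  have "integral\<^sup>L lborel ?d \<noteq> 0"
  proof
    assume "integral\<^sup>L lborel ?d = 0"
    then have "AE t in lborel. ?d t = 0"
      using integral_nonneg_eq_0_iff_AE[OF d] nonneg by simp
    then have "AE t in lborel. t \<notin> {0::real<..}"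
      by eventually_elim (use assms(3) in fastforce)
    then have "emeasure lborel {0::real<..} = 0"
      by (simp add: AE_iff_measurable[OF _ refl] greaterThan_def)
    \<comment> \<open>The unit interval, of measure 1, lies in the supposedly null
      half-line.\<close>
    moreover have "emeasure lborel {0<..<1::real} \<le> emeasure lborel {0::real<..}"
      by (intro emeasure_mono) auto
    ultimately show False
      by simp
  qed
  moreover have "0 \<le> integral\<^sup>L lborel ?d"
    using nonneg by (rule Bochner_Integration.integral_nonneg)
  ultimately show ?thesis
    using assms by (simp add: Bochner_Integration.integral_diff)
qed

text \<open>The hypothesis \<open>less\<close> is \<open>f (y + t) / f y < f (x + t) / f x\<close>
  with denominators cleared. Integrating it over \<open>t > 0\<close> gives
  \<open>f x * S y < f y * S x\<close> for the survival function \<open>S\<close>, which is the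
  claim cross-multiplied. The points may come in either order, so both directions of monotonicity
  are covered.\<close>

lemma hazard_function_less:
  fixes f :: "real \<Rightarrow> real"
  assumes f: "prob_space (density lborel (\<lambda>t. ennreal (f t)))"
      "f \<in> borel_measurable borel" "\<And>t. 0 \<le> f t"
    and pos: "\<And>t. 0 < t \<Longrightarrow> 0 < f t"
    and xy: "0 < x" "0 < y"
    and less: "\<And>t. 0 < t \<Longrightarrow> f x * f (y + t) < f y * f (x + t)"
  shows "hazard_function f x < hazard_function f y"
proof -
  define S where "S z = (\<integral>t. indicator {0<..} t * f (z + t) \<partial>lborel)" for z
  note int = one_minus_cdf_density(1)[OF f]
  \<comment> \<open>Comparison with the zero function; positivity is what permits dividing by
    \<open>S x\<close> and \<open>S y\<close> below.\<close>
  have S: "0 < S z" if "0 < z" for z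
    using lborel_integral_less_Ioi[of "\<lambda>_. 0" "\<lambda>t. f (z + t)"] int pos that
    by (simp add: S_def)
  have "f x * S y < f y * S x"
    using lborel_integral_less_Ioi[of "\<lambda>t. f x * f (y + t)" "\<lambda>t. f y * f (x + t)"] int less
    by (simp add: S_def mult.left_commute[of "indicator _ _"])
  then show ?thesis
    using S[OF xy(1)] S[OF xy(2)]
    by (simp add: hazard_function_def one_minus_cdf_density(2)[OF f] S_def[symmetric]
        divide_simps mult.commute)
qed

lemma beta_exponential_density_measurable:
  "beta_exponential_density a b \<in> borel_measurable borel"
  unfolding beta_exponential_density_def[abs_def] by measurable

lemma beta_exponential_density_pos:
  "a > 0 \<Longrightarrow> b > 0 \<Longrightarrow> 0 < x \<Longrightarrow> 0 < beta_exponential_density a b x"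
  by (simp add: beta_exponential_density_def Beta_def Gamma_real_pos)

lemma beta_exponential_density_nonneg:
  "a > 0 \<Longrightarrow> b > 0 \<Longrightarrow> 0 \<le> beta_exponential_density a b x"
  by (cases "0 < x")
    (simp_all add: beta_exponential_density_pos less_imp_le, simp add: beta_exponential_density_def)

text \<open>The factor in front of the power is symmetric in \<open>x\<close> and \<open>y\<close>,
  so swapping them changes only the base of the power, and comparing the two cross products reduces
  to comparing powers.\<close>

lemma beta_exponential_density_mult:
  assumes "0 < x" "0 < y" "0 < t"
  shows "beta_exponential_density a b x * beta_exponential_density a b (y + t) =
    (1 / Beta a b)\<^sup>2 * exp (- b * (x + y + t)) *
    ((1 - exp (- x)) * (1 - exp (- (y + t)))) powr (a - 1)"
  using assms
  by (simp add: beta_exponential_density_def powr_mult power2_eq_square)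
    (simp add: algebra_simps flip: exp_add)

text \<open>The right side minus the left side factors as
  \<open>(exp (- x) - exp (- y)) * (1 - exp (- t))\<close>.\<close>

lemma one_minus_exp_cross_less:
  fixes x y t :: real
  assumes "x < y" "0 < t"
  shows "(1 - exp (- x)) * (1 - exp (- (y + t))) < (1 - exp (- y)) * (1 - exp (- (x + t)))"
proof -
  have exp_shift: "exp (- (z + t)) = exp (- z) * exp (- t)" for z
    by (simp flip: exp_add)
  have "0 < (exp (- x) - exp (- y)) * (1 - exp (- t))"
    using assms by simp
  then show ?thesis
    unfolding exp_shift by (simp add: algebra_simps)
qed

lemma hazard_function_beta_exponential_less:
  fixes a b :: real
  assumes ab: "a > 0" "b > 0" and xy: "0 < x" "0 < y"
    and less: "\<And>t. 0 < t \<Longrightarrow> ((1 - exp (- x)) * (1 - exp (- (y + t)))) powr (a - 1)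
                          < ((1 - exp (- y)) * (1 - exp (- (x + t)))) powr (a - 1)"
  shows "hazard_function (beta_exponential_density a b) x
           < hazard_function (beta_exponential_density a b) y"
proof (rule hazard_function_less[OF prob_space_beta_exponential[OF ab]
      beta_exponential_density_measurable beta_exponential_density_nonneg[OF ab]
      beta_exponential_density_pos[OF ab] xy])
  fix t :: real assume t: "0 < t"
  have "0 < (1 / Beta a b)\<^sup>2 * exp (- b * (x + y + t))"
    using ab by (intro mult_pos_pos) (auto simp: Beta_def Gamma_eq_zero_iff dest: nonpos_Ints_nonpos)
  from mult_strict_left_mono[OF less[OF t] this]
  show "beta_exponential_density a b x * beta_exponential_density a b (y + t)
      < beta_exponential_density a b y * beta_exponential_density a b (x + t)"
    by (simp add: beta_exponential_density_mult xy t add.commute[of y x])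
qed

text \<open>For \<open>a = 1\<close> the distribution is exponential with rate \<open>b\<close>, and
  memorylessness gives \<open>S x = exp (- b * x) * S 0\<close> with \<open>S 0 = 1\<close>; the
  exponential then cancels in the quotient.\<close>

lemma hazard_function_beta_exponential_1:
  fixes b :: real
  assumes b: "b > 0" and x: "0 < x"
  shows "hazard_function (beta_exponential_density 1 b) x = b"
proof -
  let ?f = "beta_exponential_density 1 b"
  define S where "S z = (\<integral>t. indicator {0<..} t * ?f (z + t) \<partial>lborel)" for z
  have ps: "prob_space (density lborel (\<lambda>t. ennreal (?f t)))"
    using b by (intro prob_space_beta_exponential) auto
  note survival = one_minus_cdf_density(2)[OF ps beta_exponential_density_measurable
      beta_exponential_density_nonneg[OF zero_less_one b]]
  have "Beta 1 b = 1 / b"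
    using b Gamma_plus1[of b] by (simp add: Beta_def add.commute nonpos_Ints_def Gamma_eq_zero_iff)
  then have f: "?f t = b * exp (- b * t) * indicator {0<..} t" for t
    by (simp add: beta_exponential_density_def indicator_def)
  have "S x = (\<integral>t. exp (- b * x) * (indicator {0<..} t * ?f (0 + t)) \<partial>lborel)"
    unfolding S_def using x
    by (intro Bochner_Integration.integral_cong)
      (auto simp: f indicator_def algebra_simps simp flip: exp_add)
  also have "\<dots> = exp (- b * x) * S 0"
    by (simp add: S_def)
  also have "S 0 = 1"
  proof -
    \<comment> \<open>The density vanishes up to and including 0, so the cdf is 0 there and all mass
      lies in the tail.\<close>
    have "emeasure (density lborel (\<lambda>t. ennreal (?f t))) {..0} = 0"
      using beta_exponential_density_measurable[of 1 b]
      by (subst emeasure_density) (auto intro!: nn_integral_zero' AE_I2 simp: f indicator_def)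
    then show ?thesis
      using survival[of 0] by (simp add: S_def cdf_def measure_def)
  qed
  finally show ?thesis
    using x survival[of x] by (simp add: hazard_function_def S_def f)
qed

theorem proposition2:
  fixes a b :: real
  assumes "a > 0" and "b > 0"
  shows "(a < 1 \<longrightarrow> strict_antimono_on {0<..} (hazard_function (beta_exponential_density a b)))
       \<and> (a > 1 \<longrightarrow> strict_mono_on {0<..} (hazard_function (beta_exponential_density a b)))
       \<and> (a = 1 \<longrightarrow> (\<forall>x\<in>{0<..}. hazard_function (beta_exponential_density a b) x = b))"
proof (intro conjI impI)
  assume "a < 1"
  then show "strict_antimono_on {0<..} (hazard_function (beta_exponential_density a b))"
    using assms
    \<comment> \<open>The negative exponent \<open>a - 1\<close> reverses the inequality between the
      bases, so the comparison lemma is applied with the two points exchanged.\<close>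
    by (intro monotone_onI hazard_function_beta_exponential_less powr_less_mono2_neg
        one_minus_exp_cross_less) auto
next
  assume "a > 1"
  then show "strict_mono_on {0<..} (hazard_function (beta_exponential_density a b))"
    using assms
    by (intro monotone_onI hazard_function_beta_exponential_less powr_less_mono2
        one_minus_exp_cross_less) auto
next
  assume "a = 1"
  then show "\<forall>x\<in>{0<..}. hazard_function (beta_exponential_density a b) x = b"
    using hazard_function_beta_exponential_1 assms by auto
qed

end
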